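(* Let $(B,+,\circ)$ be a two-sided skew brace and let $z,w\in B$ belong to the same conjugacy class of the group $(B,\circ)$. Then the deformed solutions $r_z$ and $r_w$ are equivalent.
   Context: A skew brace $(B,+,\circ)$ is a set with two group structures $(B,+)$ (not necessarily abelian) and $(B,\circ)$ such that $a\circ(b+c)=a\circ b-a+a\circ c$ for all $a,b,c\in B$; $-a$ and $a^-$ denote the inverses of $a$ in $(B,+)$ and $(B,\circ)$, and $\circ$ binds more tightly than $+$ and $-$ (so $-a\circ z$ means $-(a\circ z)$). It is two-sided if also $(a+b)\circ c=a\circ c-c+b\circ c$ for all $a,b,c\in B$. For $z\in B$, the deformed solution $r_z:B\times B\to B\times B$ is $r_z(a,b)=\left(-a\circ z+a\circ b\circ z,\ \left(-a\circ z+a\circ b\circ z\right)^{-}\circ a\circ b\right)$ (for a two-sided skew brace, $r_z$ is a set-theoretic solution of the Yang-Baxter equation for every $z\in B$). Two solutions $r$ on $S$ and $s$ on $T$ are equivalent if there is a bijection $\varphi:S\to T$ with $(\varphi\times\varphi)r=s(\varphi\times\varphi)$. *)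

theory Defs
  imports "HOL-Algebra.Group_Action" "HOL-Algebra.Ring"
begin

(* The record 'a ring is used only as a container for two operations on one carrier.
   The operation a \<circ> b of a skew brace is a \<otimes> b, and the inverse of a for it is inv a;
   the possibly non-commutative operation + is \<oplus>, with inverse \<ominus>. The library's unary
   \<ominus> binds more tightly than \<otimes>, so -a\<circ>z is written \<ominus> (a \<otimes> z). *)

locale skew_brace = group B + add: group "add_monoid B" for B (structure) +
  assumes left_brace:
    "\<lbrakk>a \<in> carrier B; b \<in> carrier B; c \<in> carrier B\<rbrakk>
      \<Longrightarrow> a \<otimes> (b \<oplus> c) = (a \<otimes> b) \<ominus> a \<oplus> (a \<otimes> c)"

locale two_sided_skew_brace = skew_brace +
  assumes right_brace:
    "\<lbrakk>a \<in> carrier B; b \<in> carrier B; c \<in> carrier B\<rbrakk>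
      \<Longrightarrow> (a \<oplus> b) \<otimes> c = (a \<otimes> c) \<ominus> c \<oplus> (b \<otimes> c)"

definition deformed_solution :: "('a, 'm) ring_scheme \<Rightarrow> 'a \<Rightarrow> 'a \<times> 'a \<Rightarrow> 'a \<times> 'a" where
  "deformed_solution B z = (\<lambda>(a, b).
     (\<ominus>\<^bsub>B\<^esub> (a \<otimes>\<^bsub>B\<^esub> z) \<oplus>\<^bsub>B\<^esub> a \<otimes>\<^bsub>B\<^esub> b \<otimes>\<^bsub>B\<^esub> z,
      inv\<^bsub>B\<^esub> (\<ominus>\<^bsub>B\<^esub> (a \<otimes>\<^bsub>B\<^esub> z) \<oplus>\<^bsub>B\<^esub> a \<otimes>\<^bsub>B\<^esub> b \<otimes>\<^bsub>B\<^esub> z) \<otimes>\<^bsub>B\<^esub> a \<otimes>\<^bsub>B\<^esub> b))"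

(* Maps r : S \<times> S \<rightarrow> S \<times> S are total functions constrained only on S \<times> S. *)

definition equivalent_solutions ::
    "'a set \<Rightarrow> ('a \<times> 'a \<Rightarrow> 'a \<times> 'a) \<Rightarrow> 'b set \<Rightarrow> ('b \<times> 'b \<Rightarrow> 'b \<times> 'b) \<Rightarrow> bool" where
  "equivalent_solutions S r T s \<longleftrightarrow>
     r \<in> S \<times> S \<rightarrow> S \<times> S \<and> s \<in> T \<times> T \<rightarrow> T \<times> T \<and>
     (\<exists>\<phi>. bij_betw \<phi> S T \<and>
       (\<forall>x \<in> S \<times> S. map_prod \<phi> \<phi> (r x) = s (map_prod \<phi> \<phi> x)))"

definition conjugacy_classes :: "('a, 'm) monoid_scheme \<Rightarrow> 'a set set" where
  "conjugacy_classes G =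
     orbits G (carrier G) (\<lambda>g. \<lambda>h \<in> carrier G. g \<otimes>\<^bsub>G\<^esub> h \<otimes>\<^bsub>G\<^esub> inv\<^bsub>G\<^esub> g)"

end

theory Submission
  imports Defs
begin

(* Conjugation by g is additive: combining both brace laws,
   g \<circ> (a + b) \<circ> c = g \<circ> a \<circ> c - g \<circ> c + g \<circ> b \<circ> c, and the middle term vanishes when c is the
   inverse of g, because the two groups share their neutral element. So if w = g \<circ> z \<circ> g^-,
   conjugation by g is a skew brace automorphism sending z to w, and it carries r_z to r_w. *)

text \<open>With \<open>m_assoc\<close> nesting products to the right, an inverse pair meets as the
  head of a longer word; these rules cancel it there.\<close>

lemma (in group) inv_mult_cancel [simp]:
  assumes "a \<in> carrier G" "b \<in> carrier G"
  shows "inv a \<otimes> (a \<otimes> b) = b" "a \<otimes> (inv a \<otimes> b) = b"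
  using assms by (simp_all add: m_assoc [symmetric])

context skew_brace
begin

text \<open>This and the next few lemmas carry the group laws of \<open>add_monoid B\<close> over to
  ring notation for simp, without commutativity.\<close>

lemma add_closed [simp]: "\<lbrakk>a \<in> carrier B; b \<in> carrier B\<rbrakk> \<Longrightarrow> a \<oplus> b \<in> carrier B"
  using add.m_closed by simp

lemma minus_closed [simp]: "a \<in> carrier B \<Longrightarrow> \<ominus> a \<in> carrier B"
  using add.inv_closed by (simp add: a_inv_def)

lemma add_zero_closed [simp]: "\<zero> \<in> carrier B"
  using add.one_closed by simp

lemma add_assoc:
  "\<lbrakk>a \<in> carrier B; b \<in> carrier B; c \<in> carrier B\<rbrakk> \<Longrightarrow> a \<oplus> b \<oplus> c = a \<oplus> (b \<oplus> c)"
  using add.m_assoc by simp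

lemma add_zero [simp]:
  assumes "a \<in> carrier B"
  shows "\<zero> \<oplus> a = a" "a \<oplus> \<zero> = a"
  using assms add.l_one add.r_one by simp_all

lemma add_minus [simp]:
  assumes "a \<in> carrier B"
  shows "\<ominus> a \<oplus> a = \<zero>" "a \<oplus> \<ominus> a = \<zero>"
  using assms add.l_inv add.r_inv by (simp_all add: a_inv_def)

lemma add_minus_cancel [simp]:
  assumes "a \<in> carrier B" "b \<in> carrier B"
  shows "\<ominus> a \<oplus> (a \<oplus> b) = b" "a \<oplus> (\<ominus> a \<oplus> b) = b"
  using assms by (simp_all add: add_assoc [symmetric])

lemma minus_unique:
  "\<lbrakk>a \<oplus> b = \<zero>; a \<in> carrier B; b \<in> carrier B\<rbrakk> \<Longrightarrow> \<ominus> a = b"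
  by (metis add_minus_cancel(1) add_zero(2) minus_closed)

lemma minus_minus [simp]: "a \<in> carrier B \<Longrightarrow> \<ominus> (\<ominus> a) = a"
  by (rule minus_unique) simp_all

lemma minus_zero [simp]: "\<ominus> \<zero> = \<zero>"
  by (rule minus_unique) simp_all

lemma zero_eq_one: "\<zero> = \<one>"
proof -
  have "\<ominus> \<one> = \<zero> \<oplus> \<ominus> \<one> \<oplus> \<zero>" by simp
  \<comment> \<open>At a = 1, b = c = 0 the left law reads 0 - 1 + 0 = 0.\<close>
  also have "\<dots> = \<zero>"
    using left_brace [of \<one> \<zero> \<zero>, symmetric] by (simp add: a_minus_def)
  finally have "\<ominus> \<one> = \<zero>" .
  thus ?thesis by (metis minus_minus minus_zero one_closed)
qed

text \<open>Equivalence also demands that both maps preserve the square of the carrier.\<close>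

lemma deformed_solution_closed:
  assumes "z \<in> carrier B"
  shows "deformed_solution B z
    \<in> carrier B \<times> carrier B \<rightarrow> carrier B \<times> carrier B"
  using assms by (auto simp: deformed_solution_def)

end

context two_sided_skew_brace
begin

text \<open>Expand (a + (-a)) \<circ> c by the right law. As 0 = 1, the product is c, so c = a
  \<circ> c - c + (-a) \<circ> c, which is solved for the last term.\<close>

lemma minus_mult:
  assumes "a \<in> carrier B" "c \<in> carrier B"
  shows "(\<ominus> a) \<otimes> c = c \<oplus> \<ominus> (a \<otimes> c) \<oplus> c"
proof -
  have "c = a \<otimes> c \<oplus> (\<ominus> c \<oplus> (\<ominus> a) \<otimes> c)"
    using right_brace [of a "\<ominus> a" c] assms
    by (simp add: a_minus_def zero_eq_one add_assoc)
  hence "\<ominus> (a \<otimes> c) \<oplus> c = \<ominus> c \<oplus> (\<ominus> a) \<otimes> c"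
    using assms by (metis add_closed add_minus_cancel(1) m_closed minus_closed)
  thus ?thesis
    using assms by (simp add: add_assoc)
qed

lemma conj_add:
  assumes "g \<in> carrier B" "a \<in> carrier B" "b \<in> carrier B"
  shows "g \<otimes> (a \<oplus> b) \<otimes> inv g = g \<otimes> a \<otimes> inv g \<oplus> g \<otimes> b \<otimes> inv g"
  using assms
  \<comment> \<open>With c = \<open>inv g\<close>, the two laws give g \<circ> a \<circ> c - c +
    (-g) \<circ> c - c + g \<circ> b \<circ> c. By \<open>minus_mult\<close> the three middle terms
    sum to -(g \<circ> c) = -1 = 0.\<close>
  by (simp add: left_brace right_brace minus_mult a_minus_def add_assoc
      zero_eq_one [symmetric])

lemma conj_zero:
  assumes "g \<in> carrier B"
  shows "g \<otimes> \<zero> \<otimes> inv g = \<zero>"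
  using assms by (simp add: zero_eq_one)

lemma conj_minus:
  assumes "g \<in> carrier B" "a \<in> carrier B"
  shows "g \<otimes> (\<ominus> a) \<otimes> inv g = \<ominus> (g \<otimes> a \<otimes> inv g)"
  using assms by (intro minus_unique [symmetric]) (simp_all add: conj_add [symmetric] conj_zero)

lemma conj_mult:
  assumes "g \<in> carrier B" "a \<in> carrier B" "b \<in> carrier B"
  shows "g \<otimes> (a \<otimes> b) \<otimes> inv g = (g \<otimes> a \<otimes> inv g) \<otimes> (g \<otimes> b \<otimes> inv g)"
  using assms by (simp add: m_assoc)

lemma conj_inv:
  assumes "g \<in> carrier B" "a \<in> carrier B"
  shows "g \<otimes> inv a \<otimes> inv g = inv (g \<otimes> a \<otimes> inv g)"
  using assms by (simp add: inv_mult_group m_assoc)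

lemma deformed_solution_conj:
  assumes "g \<in> carrier B" "z \<in> carrier B"
  shows "equivalent_solutions (carrier B) (deformed_solution B z)
    (carrier B) (deformed_solution B (g \<otimes> z \<otimes> inv g))"
proof -
  let ?f = "\<lambda>x. g \<otimes> x \<otimes> inv g"
  have bij: "bij_betw ?f (carrier B) (carrier B)"
    using assms
    by (intro bij_betw_byWitness [where f' = "\<lambda>x. inv g \<otimes> x \<otimes> g"])
      (auto simp: m_assoc)
  have "map_prod ?f ?f (deformed_solution B z (a, b))
      = deformed_solution B (?f z) (map_prod ?f ?f (a, b))"
    if "a \<in> carrier B" "b \<in> carrier B" for a b
    using assms that
    \<comment> \<open>Both components are words in a, b, z; the rules push \<open>?f\<close> inward
      until it acts on these letters alone.\<close>
    by (simp add: deformed_solution_def conj_add conj_minus conj_mult conj_inv)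
  with bij show ?thesis
    using assms deformed_solution_closed by (auto simp: equivalent_solutions_def)
qed

end

lemma (in group) conjugacy_classes_conjugate:
  assumes "C \<in> conjugacy_classes G" "z \<in> C" "w \<in> C"
  obtains g where "g \<in> carrier G" "z \<in> carrier G" "w = g \<otimes> z \<otimes> inv g"
proof -
  obtain h a b where h: "h \<in> carrier G" "a \<in> carrier G" "b \<in> carrier G"
    "z = a \<otimes> h \<otimes> inv a" "w = b \<otimes> h \<otimes> inv b"
    using assms by (auto simp: conjugacy_classes_def orbits_def orbit_def)
  show ?thesis
  proof
    \<comment> \<open>Conjugation by \<open>inv a\<close> takes z back to the common representative
      h, and b then takes h to w.\<close>
    show "w = (b \<otimes> inv a) \<otimes> z \<otimes> inv (b \<otimes> inv a)"
      using h by (simp add: m_assoc inv_mult_group)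
  qed (use h in simp_all)
qed

theorem proposition2p12:
  fixes B :: "('a, 'm) ring_scheme" and z w :: 'a and C :: "'a set"
  assumes "two_sided_skew_brace B"
    and "C \<in> conjugacy_classes B" and "z \<in> C" and "w \<in> C"
  shows "equivalent_solutions (carrier B) (deformed_solution B z)
           (carrier B) (deformed_solution B w)"
proof -
  interpret two_sided_skew_brace B by fact
  obtain g where "g \<in> carrier B" "z \<in> carrier B" "w = g \<otimes>\<^bsub>B\<^esub> z \<otimes>\<^bsub>B\<^esub> inv\<^bsub>B\<^esub> g"
    using conjugacy_classes_conjugate assms(2-4) .
  thus ?thesis
    using deformed_solution_conj by simp
qed

end
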